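(* Let $S\subset\mathbb{R}^n$ be nonempty and closed, let $I=\{1,\ldots,m\}$, $J=\{1,\ldots,p\}$, let $f_i^L,f_i^U,g_i^L,g_i^U\colon\mathbb{R}^n\to\mathbb{R}$ ($i\in I$) and $h_j\colon\mathbb{R}^n\to\mathbb{R}$ ($j\in J$) be locally Lipschitzian functions with $0\le f_i^L(x)\le f_i^U(x)$ and $0<g_i^L(x)\le g_i^U(x)$ for all $x\in S$, $i\in I$, and let $\Omega=\{x\in S: h_j(x)\le 0,\ j\in J\}$. Let $x\in\Omega$ and let $(y,\lambda^L,\lambda^U,\mu)\in\Omega_{MW}$ be feasible for the Mond--Weir dual problem, whose objective is $\mathcal{L}(y,\lambda^L,\lambda^U,\mu):=F(y)$. (i) If $(F,h)$ is generalized convex on $S$ at $y$, then $F(x)\not\prec^s_{LU}\mathcal{L}(y,\lambda^L,\lambda^U,\mu)$. (ii) If $(F,h)$ is strictly generalized convex on $S$ at $y$, then $F(x)\not\preceq_{LU}\mathcal{L}(y,\lambda^L,\lambda^U,\mu)$.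
   Context: Variational analysis. For $S\subset\mathbb{R}^n$, $x\in S$ and $\varepsilon\ge 0$, $\widehat N_\varepsilon(x;S):=\{z^*\in\mathbb{R}^n:\limsup_{u\to x,\,u\in S}\frac{\langle z^*,u-x\rangle}{\|u-x\|}\le\varepsilon\}$. The limiting (Mordukhovich) normal cone $N(\bar x;S)$ of $S$ at $\bar x\in\mathrm{cl}\,S$ is the set of all $z^*\in\mathbb{R}^n$ for which there exist $x^k\to\bar x$ with $x^k\in S$, $\varepsilon_k\to0^+$ and $z_k^*\to z^*$ with $z_k^*\in\widehat N_{\varepsilon_k}(x^k;S)$ for all $k$. For $\varphi\colon\mathbb{R}^n\to\overline{\mathbb{R}}$ finite at $\bar x$, the limiting (Mordukhovich) subdifferential is $\partial\varphi(\bar x):=\{x^*\in\mathbb{R}^n:(x^*,-1)\in N((\bar x,\varphi(\bar x));\mathrm{epi}\,\varphi)\}$, where $\mathrm{epi}\,\varphi=\{(x,\alpha)\in\mathbb{R}^n\times\mathbb{R}:\varphi(x)\le\alpha\}$. The upper subdifferential is $\partial^+\varphi(\bar x):=-\partial(-\varphi)(\bar x)$. The polar cone of a set $C\subset\mathbb{R}^n$ is $C^\circ:=\{x^*\in\mathbb{R}^n:\langle x^*,x\rangle\le0\ \forall x\in C\}$. Sums and scalar multiples of sets are taken elementwise (Minkowski). Objective. $f_i=[f_i^L,f_i^U]$ and $g_i=[g_i^L,g_i^U]$ are interval-valued functions; for $i\in I$ and $x\in S$, $F_i(x):=\frac{f_i(x)}{g_i(x)}=\left[\frac{f_i^L(x)}{g_i^U(x)},\frac{f_i^U(x)}{g_i^L(x)}\right]$,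 and $F=(F_1,\ldots,F_m)$. The primal problem (FIMP) minimizes $F$ over $\Omega$. Interval orders. For closed bounded intervals $A=[a^L,a^U]$, $B=[b^L,b^U]$: $A\le_{LU}B$ if $a^L\le b^L$ and $a^U\le b^U$; $A<_{LU}B$ if $A\le_{LU}B$ and $A\ne B$; $A<^s_{LU}B$ if $a^L<b^L$ and $a^U<b^U$. For $m$-tuples of intervals $\mathcal{A}=(A_1,\ldots,A_m)$, $\mathcal{B}=(B_1,\ldots,B_m)$: $\mathcal{A}\preceq_{LU}\mathcal{B}$ means $A_i\le_{LU}B_i$ for all $i\in I$ and $A_k<_{LU}B_k$ for at least one $k\in I$; $\mathcal{A}\prec^s_{LU}\mathcal{B}$ means $A_i<^s_{LU}B_i$ for all $i\in I$; $\not\preceq_{LU}$ and $\not\prec^s_{LU}$ denote the negations. Dual feasible set. $\Omega_{MW}$ is the set of all $(y,\lambda^L,\lambda^U,\mu)\in S\times\mathbb{R}^m_+\times\mathbb{R}^m_+\times\mathbb{R}^p_+$ such that $$0\in \sum_{i\in I}\frac{\lambda_i^L}{g_i^U(y)} \left[\partial f_i^L(y)-\frac{f_i^L(y)}{g_i^U(y)}\partial^+ g_i^U(y)\right]+\sum_{i\in I}\frac{\lambda_i^U}{g_i^L(y)} \left[\partial f_i^U(y)-\frac{f_i^U(y)}{g_i^L(y)}\partial^+ g_i^L(y)\right]+\sum_{j\in J}\mu_j\partial h_j(y)+N(y;S),$$ $\sum_{j\in J}\mu_jh_j(y)\ge0$, $\sum_{i\in I}(\lambda_i^L+\lambda_i^U)+\sum_{j\in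 J}\mu_j=1$, and $(\lambda^L,\lambda^U)\ne(0,0)$. The dual problem is to LU-maximize $\mathcal{L}(y,\lambda^L,\lambda^U,\mu):=F(y)$ over $\Omega_{MW}$. Generalized convexity. $(F,h)$ is generalized convex on $S$ at $\bar x\in S$ if for any $x\in S$, $x_i^{*L}\in\partial f_i^L(\bar x)$, $x_i^{*U}\in\partial f_i^U(\bar x)$, $y_i^{*L}\in\partial^+g_i^L(\bar x)$, $y_i^{*U}\in\partial^+g_i^U(\bar x)$, $i\in I$, and $z_j^*\in\partial h_j(\bar x)$, $j\in J$, there exists $\nu\in[N(\bar x;S)]^\circ$ such that for all $i\in I$, $j\in J$: $f_i^L(x)-f_i^L(\bar x)\ge\langle x_i^{*L},\nu\rangle$, $f_i^U(x)-f_i^U(\bar x)\ge\langle x_i^{*U},\nu\rangle$, $g_i^L(x)-g_i^L(\bar x)\le\langle y_i^{*L},\nu\rangle$, $g_i^U(x)-g_i^U(\bar x)\le\langle y_i^{*U},\nu\rangle$, $h_j(x)-h_j(\bar x)\ge\langle z_j^*,\nu\rangle$. $(F,h)$ is strictly generalized convex on $S$ at $\bar x$ if the same holds for any $x\in S\setminus\{\bar x\}$ (and any such subgradients) with the first two inequalities (those for $f_i^L$ and $f_i^U$) strict. *)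

theory Defs
  imports "HOL-Analysis.Analysis" "HOL-Library.Interval"
begin

section \<open>Variational analysis\<close>

text \<open>
  The quotient is taken in \<^typ>\<open>ereal\<close> so that the upper limit is unrestricted. The filter
  \<open>at x within S\<close> leaves out \<open>u = x\<close>; at an isolated point of \<open>S\<close> it is trivial, the upper limit
  is \<open>-\<infinity>\<close>, and every vector is a normal.
\<close>

definition eps_normals :: "real \<Rightarrow> 'a::euclidean_space set \<Rightarrow> 'a \<Rightarrow> 'a set" where
  "eps_normals \<epsilon> S x =
     {z. Limsup (at x within S) (\<lambda>u. ereal (inner z (u - x) / norm (u - x))) \<le> ereal \<epsilon>}"

definition limiting_normal_cone :: "'a::euclidean_space set \<Rightarrow> 'a \<Rightarrow> 'a set" where
  "limiting_normal_cone S x =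
     {z. \<exists>X \<epsilon> Z. X \<longlonglongrightarrow> x \<and> (\<forall>k::nat. X k \<in> S) \<and>
                 \<epsilon> \<longlonglongrightarrow> 0 \<and> (\<forall>k. 0 < \<epsilon> k) \<and>
                 Z \<longlonglongrightarrow> z \<and> (\<forall>k. Z k \<in> eps_normals (\<epsilon> k) S (X k))}"

definition limiting_subdifferential :: "('a::euclidean_space \<Rightarrow> real) \<Rightarrow> 'a \<Rightarrow> 'a set" where
  "limiting_subdifferential \<phi> x =
     {x'. (x', - 1) \<in> limiting_normal_cone (epigraph UNIV \<phi>) (x, \<phi> x)}"

text \<open>The outer minus is the elementwise one, not the set complement.\<close>

definition upper_subdifferential :: "('a::euclidean_space \<Rightarrow> real) \<Rightarrow> 'a \<Rightarrow> 'a set" where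
  "upper_subdifferential \<phi> x = uminus ` limiting_subdifferential (\<lambda>u. - \<phi> u) x"

definition polar_cone :: "'a::euclidean_space set \<Rightarrow> 'a set" where
  "polar_cone C = {x'. \<forall>x\<in>C. inner x' x \<le> 0}"

definition locally_lipschitz :: "('a::metric_space \<Rightarrow> 'b::metric_space) \<Rightarrow> bool" where
  "locally_lipschitz f \<longleftrightarrow> (\<forall>x. \<exists>r>0. \<exists>L. L-lipschitz_on (cball x r) f)"


section \<open>Interval orders\<close>

text \<open>
  The order that the library puts on \<^typ>\<open>real interval\<close> is inclusion, so the
  lower-upper orders get constants of their own.
\<close>

definition LU_le :: "real interval \<Rightarrow> real interval \<Rightarrow> bool" where
  "LU_le A B \<longleftrightarrow> lower A \<le> lower B \<and> upper A \<le> upper B"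

definition LU_less :: "real interval \<Rightarrow> real interval \<Rightarrow> bool" where
  "LU_less A B \<longleftrightarrow> LU_le A B \<and> A \<noteq> B"

definition LU_sless :: "real interval \<Rightarrow> real interval \<Rightarrow> bool" where
  "LU_sless A B \<longleftrightarrow> lower A < lower B \<and> upper A < upper B"

text \<open>
  An \<open>m\<close>-tuple is a function on \<^typ>\<open>nat\<close> of which only the values on \<open>{1..m}\<close> are used; the
  same encoding serves for the families \<open>f\<close>, \<open>g\<close>, \<open>h\<close> and for the multipliers.
\<close>

definition LU_prec :: "nat \<Rightarrow> (nat \<Rightarrow> real interval) \<Rightarrow> (nat \<Rightarrow> real interval) \<Rightarrow> bool" where
  "LU_prec m A B \<longleftrightarrow> (\<forall>i\<in>{1..m}. LU_le (A i) (B i)) \<and> (\<exists>k\<in>{1..m}. LU_less (A k) (B k))"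

definition LU_sprec :: "nat \<Rightarrow> (nat \<Rightarrow> real interval) \<Rightarrow> (nat \<Rightarrow> real interval) \<Rightarrow> bool" where
  "LU_sprec m A B \<longleftrightarrow> (\<forall>i\<in>{1..m}. LU_sless (A i) (B i))"


section \<open>The fractional interval-valued problem and its dual\<close>

text \<open>
  \<^const>\<open>Interval\<close> is specified only on pairs of ordered end points; for the ratio below they are
  ordered at every point where \<open>0 \<le> fL i x \<le> fU i x\<close> and \<open>0 < gL i x \<le> gU i x\<close>.
\<close>

definition interval_ratio ::
  "(nat \<Rightarrow> 'a \<Rightarrow> real) \<Rightarrow> (nat \<Rightarrow> 'a \<Rightarrow> real) \<Rightarrow> (nat \<Rightarrow> 'a \<Rightarrow> real) \<Rightarrow> (nat \<Rightarrow> 'a \<Rightarrow> real)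
    \<Rightarrow> 'a \<Rightarrow> nat \<Rightarrow> real interval" where
  "interval_ratio fL fU gL gU x i = Interval (fL i x / gU i x, fU i x / gL i x)"

definition feasible_set :: "nat \<Rightarrow> 'a set \<Rightarrow> (nat \<Rightarrow> 'a \<Rightarrow> real) \<Rightarrow> 'a set" where
  "feasible_set p S h = {x \<in> S. \<forall>j\<in>{1..p}. h j x \<le> 0}"

text \<open>
  Sums of sets are Minkowski sums. The binary minus on sets would be set difference, so
  \<open>A - c B\<close> is written as \<open>A + (- c) B\<close> with an image.
\<close>

definition mond_weir_feasible_set ::
  "nat \<Rightarrow> nat \<Rightarrow> 'a::euclidean_space set
    \<Rightarrow> (nat \<Rightarrow> 'a \<Rightarrow> real) \<Rightarrow> (nat \<Rightarrow> 'a \<Rightarrow> real) \<Rightarrow> (nat \<Rightarrow> 'a \<Rightarrow> real) \<Rightarrow> (nat \<Rightarrow> 'a \<Rightarrow> real)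
    \<Rightarrow> (nat \<Rightarrow> 'a \<Rightarrow> real) \<Rightarrow> ('a \<times> (nat \<Rightarrow> real) \<times> (nat \<Rightarrow> real) \<times> (nat \<Rightarrow> real)) set" where
  "mond_weir_feasible_set m p S fL fU gL gU h =
     {(y, lamL, lamU, \<mu>).
        y \<in> S \<and>
        (\<forall>i\<in>{1..m}. 0 \<le> lamL i) \<and> (\<forall>i\<in>{1..m}. 0 \<le> lamU i) \<and> (\<forall>j\<in>{1..p}. 0 \<le> \<mu> j) \<and>
        0 \<in> (\<Sum>i\<in>{1..m}. (*\<^sub>R) (lamL i / gU i y) `
                (limiting_subdifferential (fL i) y
                  + (*\<^sub>R) (- (fL i y / gU i y)) ` upper_subdifferential (gU i) y))
          + (\<Sum>i\<in>{1..m}. (*\<^sub>R) (lamU i / gL i y) `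
                (limiting_subdifferential (fU i) y
                  + (*\<^sub>R) (- (fU i y / gL i y)) ` upper_subdifferential (gL i) y))
          + (\<Sum>j\<in>{1..p}. (*\<^sub>R) (\<mu> j) ` limiting_subdifferential (h j) y)
          + limiting_normal_cone S y \<and>
        (\<Sum>j\<in>{1..p}. \<mu> j * h j y) \<ge> 0 \<and>
        (\<Sum>i\<in>{1..m}. lamL i + lamU i) + (\<Sum>j\<in>{1..p}. \<mu> j) = 1 \<and>
        \<not> (\<forall>i\<in>{1..m}. lamL i = 0 \<and> lamU i = 0)}"

definition mond_weir_objective ::
  "(nat \<Rightarrow> 'a \<Rightarrow> real) \<Rightarrow> (nat \<Rightarrow> 'a \<Rightarrow> real) \<Rightarrow> (nat \<Rightarrow> 'a \<Rightarrow> real) \<Rightarrow> (nat \<Rightarrow> 'a \<Rightarrow> real)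
    \<Rightarrow> 'a \<times> (nat \<Rightarrow> real) \<times> (nat \<Rightarrow> real) \<times> (nat \<Rightarrow> real) \<Rightarrow> nat \<Rightarrow> real interval" where
  "mond_weir_objective fL fU gL gU = (\<lambda>(y, lamL, lamU, \<mu>). interval_ratio fL fU gL gU y)"


section \<open>Generalized convexity\<close>

definition generalized_convex_at ::
  "nat \<Rightarrow> nat \<Rightarrow> 'a::euclidean_space set
    \<Rightarrow> (nat \<Rightarrow> 'a \<Rightarrow> real) \<Rightarrow> (nat \<Rightarrow> 'a \<Rightarrow> real) \<Rightarrow> (nat \<Rightarrow> 'a \<Rightarrow> real) \<Rightarrow> (nat \<Rightarrow> 'a \<Rightarrow> real)
    \<Rightarrow> (nat \<Rightarrow> 'a \<Rightarrow> real) \<Rightarrow> 'a \<Rightarrow> bool" where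
  "generalized_convex_at m p S fL fU gL gU h xb \<longleftrightarrow>
     (\<forall>x\<in>S. \<forall>xL xU yL yU z.
        (\<forall>i\<in>{1..m}. xL i \<in> limiting_subdifferential (fL i) xb \<and>
                    xU i \<in> limiting_subdifferential (fU i) xb \<and>
                    yL i \<in> upper_subdifferential (gL i) xb \<and>
                    yU i \<in> upper_subdifferential (gU i) xb) \<and>
        (\<forall>j\<in>{1..p}. z j \<in> limiting_subdifferential (h j) xb)
        \<longrightarrow> (\<exists>\<nu>\<in>polar_cone (limiting_normal_cone S xb).
              (\<forall>i\<in>{1..m}. fL i x - fL i xb \<ge> inner (xL i) \<nu> \<and>
                          fU i x - fU i xb \<ge> inner (xU i) \<nu> \<and>
                          gL i x - gL i xb \<le> inner (yL i) \<nu> \<and>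
                          gU i x - gU i xb \<le> inner (yU i) \<nu>) \<and>
              (\<forall>j\<in>{1..p}. h j x - h j xb \<ge> inner (z j) \<nu>)))"

definition strictly_generalized_convex_at ::
  "nat \<Rightarrow> nat \<Rightarrow> 'a::euclidean_space set
    \<Rightarrow> (nat \<Rightarrow> 'a \<Rightarrow> real) \<Rightarrow> (nat \<Rightarrow> 'a \<Rightarrow> real) \<Rightarrow> (nat \<Rightarrow> 'a \<Rightarrow> real) \<Rightarrow> (nat \<Rightarrow> 'a \<Rightarrow> real)
    \<Rightarrow> (nat \<Rightarrow> 'a \<Rightarrow> real) \<Rightarrow> 'a \<Rightarrow> bool" where
  "strictly_generalized_convex_at m p S fL fU gL gU h xb \<longleftrightarrow>
     (\<forall>x\<in>S - {xb}. \<forall>xL xU yL yU z.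
        (\<forall>i\<in>{1..m}. xL i \<in> limiting_subdifferential (fL i) xb \<and>
                    xU i \<in> limiting_subdifferential (fU i) xb \<and>
                    yL i \<in> upper_subdifferential (gL i) xb \<and>
                    yU i \<in> upper_subdifferential (gU i) xb) \<and>
        (\<forall>j\<in>{1..p}. z j \<in> limiting_subdifferential (h j) xb)
        \<longrightarrow> (\<exists>\<nu>\<in>polar_cone (limiting_normal_cone S xb).
              (\<forall>i\<in>{1..m}. fL i x - fL i xb > inner (xL i) \<nu> \<and>
                          fU i x - fU i xb > inner (xU i) \<nu> \<and>
                          gL i x - gL i xb \<le> inner (yL i) \<nu> \<and>
                          gU i x - gU i xb \<le> inner (yU i) \<nu>) \<and>
              (\<forall>j\<in>{1..p}. h j x - h j xb \<ge> inner (z j) \<nu>)))"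

end

theory Submission
  imports Defs
begin

text \<open>
  Pair the stationarity inclusion with the direction \<open>\<nu>\<close> supplied by generalized convexity. The
  normal contributes a nonpositive number, and since \<open>r = f y / g y \<ge> 0\<close> a bracket is at most
  \<open>f x - f y - r (g x - g y) = f x - r g x\<close>, which is nonpositive exactly when \<open>f x / g x \<le> r\<close>.
  If \<open>F x\<close> were below \<open>F y\<close>, a bracket with a positive multiplier would be negative, while all the
  others and the constraint terms are nonpositive, so the total could not be \<open>0\<close>. In the strict
  case \<open>x \<noteq> y\<close> is automatic because \<open>F x \<noteq> F y\<close>.
\<close>

text \<open>Finiteness of \<open>A\<close> matters: over an infinite index set the sum defaults to
  \<open>{0}\<close>, even when some \<open>B i\<close> is empty and no selection \<open>s\<close>
  exists.\<close>

lemma mem_sum_setD: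
  assumes "x \<in> (\<Sum>i\<in>A. B i)" and "finite A"
  obtains s where "\<And>i. i \<in> A \<Longrightarrow> s i \<in> B i" and "x = sum s A"
  using assms by (auto simp: set_sum_alt)

text \<open>Turns membership in a Minkowski sum of the dual constraint into one vector equation:
  \<open>a\<close> will hold the subgradients of the numerators, \<open>b\<close> the upper
  subgradients of the denominators, and \<open>r\<close> the ratios at the dual point.\<close>

lemma mem_sum_scaled_quotient_rule:
  fixes P Q :: "'i \<Rightarrow> 'a::real_vector set"
  assumes "v \<in> (\<Sum>i\<in>A. (*\<^sub>R) (c i) ` (P i + (*\<^sub>R) (- (r i)) ` Q i))" and "finite A"
  obtains a b where "\<And>i. i \<in> A \<Longrightarrow> a i \<in> P i" and "\<And>i. i \<in> A \<Longrightarrow> b i \<in> Q i"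
    and "v = (\<Sum>i\<in>A. c i *\<^sub>R (a i - r i *\<^sub>R b i))"
proof -
  obtain s where s: "\<And>i. i \<in> A \<Longrightarrow> s i \<in> (*\<^sub>R) (c i) ` (P i + (*\<^sub>R) (- (r i)) ` Q i)"
    and v: "v = sum s A"
    using mem_sum_setD[OF assms] by blast
  \<comment> \<open>Unpacking is done for each \<open>i\<close> separately; choice then assembles
    the families \<open>a\<close> and \<open>b\<close>, whose values outside \<open>A\<close> do not
    matter.\<close>
  have "\<exists>a b. a \<in> P i \<and> b \<in> Q i \<and> s i = c i *\<^sub>R (a - r i *\<^sub>R b)" if "i \<in> A" for i
    using s[OF that] by (fastforce elim!: set_plus_elim)
  then obtain a b where
    "\<And>i. i \<in> A \<Longrightarrow> a i \<in> P i \<and> b i \<in> Q i \<and> s i = c i *\<^sub>R (a i - r i *\<^sub>R b i)"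
    by metis
  with v show thesis
    by (intro that[of a b]) auto
qed

lemma mem_sum_scaled:
  fixes P :: "'i \<Rightarrow> 'a::real_vector set"
  assumes "v \<in> (\<Sum>i\<in>A. (*\<^sub>R) (c i) ` P i)" and "finite A"
  obtains a where "\<And>i. i \<in> A \<Longrightarrow> a i \<in> P i" and "v = (\<Sum>i\<in>A. c i *\<^sub>R a i)"
proof -
  obtain s where s: "\<And>i. i \<in> A \<Longrightarrow> s i \<in> (*\<^sub>R) (c i) ` P i" and v: "v = sum s A"
    using mem_sum_setD[OF assms] by blast
  have "\<exists>a. a \<in> P i \<and> s i = c i *\<^sub>R a" if "i \<in> A" for i
    using s[OF that] by blast
  then obtain a where "\<And>i. i \<in> A \<Longrightarrow> a i \<in> P i \<and> s i = c i *\<^sub>R a i"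
    by metis
  with v show thesis
    by (intro that[of a]) auto
qed

text \<open>The subgradients are fixed before \<open>\<nu>\<close> is quantified, because
  generalized convexity picks \<open>\<nu>\<close> only after it has been handed the subgradients.
  \<open>xL\<close> goes with \<open>yU\<close> and \<open>xU\<close> with \<open>yL\<close>, since
  the lower end of the ratio is \<open>fL / gU\<close> and the upper one is
  \<open>fU / gL\<close>.\<close>

lemma mond_weir_pairing:
  assumes "(y, lamL, lamU, \<mu>) \<in> mond_weir_feasible_set m p S fL fU gL gU h"
  obtains xL xU yL yU z
  where "\<forall>i\<in>{1..m}. xL i \<in> limiting_subdifferential (fL i) y \<and>
                    xU i \<in> limiting_subdifferential (fU i) y \<and>
                    yL i \<in> upper_subdifferential (gL i) y \<and>
                    yU i \<in> upper_subdifferential (gU i) y"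
    and "\<forall>j\<in>{1..p}. z j \<in> limiting_subdifferential (h j) y"
    and "\<And>\<nu>. \<nu> \<in> polar_cone (limiting_normal_cone S y) \<Longrightarrow>
           0 \<le> (\<Sum>i\<in>{1..m}. lamL i / gU i y * (inner (xL i) \<nu> - fL i y / gU i y * inner (yU i) \<nu>))
             + (\<Sum>i\<in>{1..m}. lamU i / gL i y * (inner (xU i) \<nu> - fU i y / gL i y * inner (yL i) \<nu>))
             + (\<Sum>j\<in>{1..p}. \<mu> j * inner (z j) \<nu>)"
proof -
  let ?A = "\<Sum>i\<in>{1..m}. (*\<^sub>R) (lamL i / gU i y) ` (limiting_subdifferential (fL i) y
              + (*\<^sub>R) (- (fL i y / gU i y)) ` upper_subdifferential (gU i) y)"
  let ?B = "\<Sum>i\<in>{1..m}. (*\<^sub>R) (lamU i / gL i y) ` (limiting_subdifferential (fU i) y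
              + (*\<^sub>R) (- (fU i y / gL i y)) ` upper_subdifferential (gL i) y)"
  let ?C = "\<Sum>j\<in>{1..p}. (*\<^sub>R) (\<mu> j) ` limiting_subdifferential (h j) y"
  have "0 \<in> ?A + ?B + ?C + limiting_normal_cone S y"
    using assms by (simp add: mond_weir_feasible_set_def)
  then obtain a b c n where a: "a \<in> ?A" and b: "b \<in> ?B" and c: "c \<in> ?C"
    and n: "n \<in> limiting_normal_cone S y" and zero: "0 = a + b + c + n"
    by (elim set_plus_elim) blast
  obtain xL yU where L: "\<And>i. i \<in> {1..m} \<Longrightarrow> xL i \<in> limiting_subdifferential (fL i) y"
      "\<And>i. i \<in> {1..m} \<Longrightarrow> yU i \<in> upper_subdifferential (gU i) y"
      "a = (\<Sum>i\<in>{1..m}. (lamL i / gU i y) *\<^sub>R (xL i - (fL i y / gU i y) *\<^sub>R yU i))"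
    using mem_sum_scaled_quotient_rule[OF a] by blast
  obtain xU yL where U: "\<And>i. i \<in> {1..m} \<Longrightarrow> xU i \<in> limiting_subdifferential (fU i) y"
      "\<And>i. i \<in> {1..m} \<Longrightarrow> yL i \<in> upper_subdifferential (gL i) y"
      "b = (\<Sum>i\<in>{1..m}. (lamU i / gL i y) *\<^sub>R (xU i - (fU i y / gL i y) *\<^sub>R yL i))"
    using mem_sum_scaled_quotient_rule[OF b] by blast
  obtain z where z: "\<And>j. j \<in> {1..p} \<Longrightarrow> z j \<in> limiting_subdifferential (h j) y"
      "c = (\<Sum>j\<in>{1..p}. \<mu> j *\<^sub>R z j)"
    using mem_sum_scaled[OF c] by blast
  show thesis
  proof (rule that)
    show "\<forall>i\<in>{1..m}. xL i \<in> limiting_subdifferential (fL i) y \<and>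
                    xU i \<in> limiting_subdifferential (fU i) y \<and>
                    yL i \<in> upper_subdifferential (gL i) y \<and>
                    yU i \<in> upper_subdifferential (gU i) y"
      using L U by blast
    show "\<forall>j\<in>{1..p}. z j \<in> limiting_subdifferential (h j) y"
      using z by blast
    fix \<nu> assume "\<nu> \<in> polar_cone (limiting_normal_cone S y)"
    \<comment> \<open>Polarity enters here: the share of the normal in the zero sum is nonpositive,
      so the other three shares add up to a nonnegative number.\<close>
    then have "inner n \<nu> \<le> 0"
      using n inner_commute[of n \<nu>] by (simp add: polar_cone_def)
    moreover have "inner a \<nu> + inner b \<nu> + inner c \<nu> + inner n \<nu> = 0"
      using zero by (metis inner_add_left inner_zero_left)
    ultimately have "0 \<le> inner a \<nu> + inner b \<nu> + inner c \<nu>"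
      by linarith
    then show "0 \<le> (\<Sum>i\<in>{1..m}. lamL i / gU i y * (inner (xL i) \<nu> - fL i y / gU i y * inner (yU i) \<nu>))
             + (\<Sum>i\<in>{1..m}. lamU i / gL i y * (inner (xU i) \<nu> - fU i y / gL i y * inner (yL i) \<nu>))
             + (\<Sum>j\<in>{1..p}. \<mu> j * inner (z j) \<nu>)"
      by (simp only: L(3) U(3) z(2) inner_sum_left inner_scaleR_left inner_diff_left)
  qed
qed

text \<open>Put \<open>r = f0 / g0\<close>, so that \<open>r * g0 = f0\<close>. Then
  \<open>a - r * b \<le> f - f0 - r * (g - g0) = f - r * g \<le> 0\<close>, and the last assumption
  makes the first or the last step strict. The disjunction lets one estimate serve both parts:
  strictness comes from the ratios in (i) and from the subgradient inequality in (ii).\<close>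

lemma quotient_linearization_less:
  fixes a b f f0 g g0 :: real
  assumes "0 \<le> f0" "0 < g0" "0 < g" "a \<le> f - f0" "g - g0 \<le> b" "f / g \<le> f0 / g0"
    and "a < f - f0 \<or> f / g < f0 / g0"
  shows "a - f0 / g0 * b < 0"
proof -
  \<comment> \<open>The factor \<open>f0 / g0\<close> is nonnegative, so the estimate on the
    denominators keeps its direction.\<close>
  have "f0 / g0 * (g - g0) \<le> f0 / g0 * b"
    using assms by (intro mult_left_mono) auto
  moreover have "f0 / g0 * (g - g0) = f0 / g0 * g - f0"
    using assms by (simp add: field_simps)
  \<comment> \<open>Multiplying by \<open>g > 0\<close> removes the ratio \<open>f / g\<close>; what
    remains is linear with the products as atoms.\<close>
  moreover have "f \<le> f0 / g0 * g" "a < f - f0 \<or> f < f0 / g0 * g"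
    using assms(6,7) \<open>0 < g\<close> by (simp_all only: pos_divide_le_eq pos_divide_less_eq)
  ultimately show ?thesis
    using assms(4) by linarith
qed

text \<open>Common core of both parts. \<open>le\<close> follows from either assumed order, and the
  disjunctions in \<open>convex\<close> admit either source of strictness. \<open>convex\<close>
  speaks only of this one \<open>x\<close>, so strict generalized convexity, which excludes the base
  point, can supply it once \<open>x\<close> is known to differ from \<open>y\<close>.\<close>

lemma mond_weir_not_improved:
  assumes pos: "\<And>i u. i \<in> {1..m} \<Longrightarrow> u \<in> S \<Longrightarrow>
      0 \<le> fL i u \<and> 0 \<le> fU i u \<and> 0 < gL i u \<and> 0 < gU i u"
    and x: "x \<in> feasible_set p S h"
    and feas: "(y, lamL, lamU, \<mu>) \<in> mond_weir_feasible_set m p S fL fU gL gU h"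
    and le: "\<And>i. i \<in> {1..m} \<Longrightarrow>
      fL i x / gU i x \<le> fL i y / gU i y \<and> fU i x / gL i x \<le> fU i y / gL i y"
    and convex: "\<And>xL xU yL yU z.
      \<forall>i\<in>{1..m}. xL i \<in> limiting_subdifferential (fL i) y \<and>
                 xU i \<in> limiting_subdifferential (fU i) y \<and>
                 yL i \<in> upper_subdifferential (gL i) y \<and>
                 yU i \<in> upper_subdifferential (gU i) y \<Longrightarrow>
      \<forall>j\<in>{1..p}. z j \<in> limiting_subdifferential (h j) y \<Longrightarrow>
      \<exists>\<nu>\<in>polar_cone (limiting_normal_cone S y).
        (\<forall>i\<in>{1..m}. inner (xL i) \<nu> \<le> fL i x - fL i y \<and>
                    inner (xU i) \<nu> \<le> fU i x - fU i y \<and>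
                    gL i x - gL i y \<le> inner (yL i) \<nu> \<and>
                    gU i x - gU i y \<le> inner (yU i) \<nu> \<and>
                    (inner (xL i) \<nu> < fL i x - fL i y \<or> fL i x / gU i x < fL i y / gU i y) \<and>
                    (inner (xU i) \<nu> < fU i x - fU i y \<or> fU i x / gL i x < fU i y / gL i y)) \<and>
        (\<forall>j\<in>{1..p}. inner (z j) \<nu> \<le> h j x - h j y)"
  shows False
proof -
  have xS: "x \<in> S" and hx: "\<And>j. j \<in> {1..p} \<Longrightarrow> h j x \<le> 0"
    using x by (auto simp: feasible_set_def)
  have yS: "y \<in> S" and lamL: "\<And>i. i \<in> {1..m} \<Longrightarrow> 0 \<le> lamL i"
    and lamU: "\<And>i. i \<in> {1..m} \<Longrightarrow> 0 \<le> lamU i" and mu: "\<And>j. j \<in> {1..p} \<Longrightarrow> 0 \<le> \<mu> j"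
    and comp: "0 \<le> (\<Sum>j\<in>{1..p}. \<mu> j * h j y)"
    and nz: "\<not> (\<forall>i\<in>{1..m}. lamL i = 0 \<and> lamU i = 0)"
    using feas by (auto simp: mond_weir_feasible_set_def)
  obtain xL xU yL yU z where sub: "\<forall>i\<in>{1..m}. xL i \<in> limiting_subdifferential (fL i) y \<and>
                    xU i \<in> limiting_subdifferential (fU i) y \<and>
                    yL i \<in> upper_subdifferential (gL i) y \<and>
                    yU i \<in> upper_subdifferential (gU i) y"
      "\<forall>j\<in>{1..p}. z j \<in> limiting_subdifferential (h j) y"
    and pairing: "\<And>\<nu>. \<nu> \<in> polar_cone (limiting_normal_cone S y) \<Longrightarrow>
           0 \<le> (\<Sum>i\<in>{1..m}. lamL i / gU i y * (inner (xL i) \<nu> - fL i y / gU i y * inner (yU i) \<nu>))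
             + (\<Sum>i\<in>{1..m}. lamU i / gL i y * (inner (xU i) \<nu> - fU i y / gL i y * inner (yL i) \<nu>))
             + (\<Sum>j\<in>{1..p}. \<mu> j * inner (z j) \<nu>)"
    using mond_weir_pairing[OF feas] by blast
  obtain \<nu> where nu: "\<nu> \<in> polar_cone (limiting_normal_cone S y)"
    and obj: "\<And>i. i \<in> {1..m} \<Longrightarrow> inner (xL i) \<nu> \<le> fL i x - fL i y \<and>
                    inner (xU i) \<nu> \<le> fU i x - fU i y \<and>
                    gL i x - gL i y \<le> inner (yL i) \<nu> \<and>
                    gU i x - gU i y \<le> inner (yU i) \<nu> \<and>
                    (inner (xL i) \<nu> < fL i x - fL i y \<or> fL i x / gU i x < fL i y / gU i y) \<and>
                    (inner (xU i) \<nu> < fU i x - fU i y \<or> fU i x / gL i x < fU i y / gL i y)"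
    and con: "\<And>j. j \<in> {1..p} \<Longrightarrow> inner (z j) \<nu> \<le> h j x - h j y"
    using convex[OF sub] by blast
  define a where
    "a i = inner (xL i) \<nu> - fL i y / gU i y * inner (yU i) \<nu>" for i
  define b where
    "b i = inner (xU i) \<nu> - fU i y / gL i y * inner (yL i) \<nu>" for i
  \<comment> \<open>Strictness is established at every index and for both ends, since it is not
    known in advance which multiplier is positive.\<close>
  have neg: "a i < 0" "b i < 0" if i: "i \<in> {1..m}" for i
  proof -
    note facts = pos[OF i xS] pos[OF i yS] obj[OF i] le[OF i]
    show "a i < 0"
      unfolding a_def
      by (rule quotient_linearization_less[where f = "fL i x" and g = "gU i x"])
        (use facts in simp_all)
    show "b i < 0"
      unfolding b_def
      by (rule quotient_linearization_less[where f = "fU i x" and g = "gL i x"])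
        (use facts in simp_all)
  qed
  \<comment> \<open>Lower and upper terms of the same index are merged, so that one strict index
    \<open>k\<close> suffices whether \<open>lamL k\<close> or \<open>lamU k\<close> is the positive
    multiplier.\<close>
  let ?t = "\<lambda>i. lamL i / gU i y * a i + lamU i / gL i y * b i"
  have term_le: "lamL i / gU i y * a i \<le> 0" "lamU i / gL i y * b i \<le> 0" if "i \<in> {1..m}" for i
    using neg[OF that] lamL[OF that] lamU[OF that] pos[OF that yS]
    by (auto intro!: divide_nonpos_pos mult_nonneg_nonpos)
  obtain k where k: "k \<in> {1..m}" "0 < lamL k \<or> 0 < lamU k"
    using nz lamL lamU by (metis less_eq_real_def)
  have "?t k < 0"
    using k(2)
  proof
    assume "0 < lamL k"
    then have "lamL k / gU k y * a k < 0"
      using neg(1)[OF k(1)] pos[OF k(1) yS] by (simp add: mult_pos_neg divide_neg_pos)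
    then show ?thesis
      using term_le(2)[OF k(1)] by linarith
  next
    assume "0 < lamU k"
    then have "lamU k / gL k y * b k < 0"
      using neg(2)[OF k(1)] pos[OF k(1) yS] by (simp add: mult_pos_neg divide_neg_pos)
    then show ?thesis
      using term_le(1)[OF k(1)] by linarith
  qed
  then have "(\<Sum>i\<in>{1..m}. ?t i) < (\<Sum>i\<in>{1..m}. 0)"
    using term_le k(1) by (intro sum_strict_mono_ex1) (auto intro: add_nonpos_nonpos)
  \<comment> \<open>Feasibility of \<open>x\<close> gives
    \<open>h j x - h j y \<le> - h j y\<close>; after weighting by \<open>\<mu> j \<ge> 0\<close>
    and summing, the right side is nonpositive by the dual condition \<open>comp\<close>.\<close>
  moreover have "(\<Sum>j\<in>{1..p}. \<mu> j * inner (z j) \<nu>) \<le> (\<Sum>j\<in>{1..p}. - (\<mu> j * h j y))"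
  proof (rule sum_mono)
    fix j assume j: "j \<in> {1..p}"
    have "inner (z j) \<nu> \<le> - h j y"
      using con[OF j] hx[OF j] by linarith
    then show "\<mu> j * inner (z j) \<nu> \<le> - (\<mu> j * h j y)"
      using mult_left_mono[OF _ mu[OF j]] by fastforce
  qed
  ultimately show False
    using pairing[OF nu, folded a_def b_def] comp by (simp add: sum.distrib sum_negf)
qed

text \<open>\<open>Interval\<close> has prescribed end points only on an ordered pair. The order
  holds because passing from the lower to the upper ratio does not decrease the nonnegative
  numerator and does not increase the positive denominator.\<close>

lemma interval_ratio_bounds:
  assumes "0 \<le> fL i x" "fL i x \<le> fU i x" "0 < gL i x" "gL i x \<le> gU i x"
  shows "lower (interval_ratio fL fU gL gU x i) = fL i x / gU i x"
    and "upper (interval_ratio fL fU gL gU x i) = fU i x / gL i x"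
proof -
  have "fL i x / gU i x \<le> fU i x / gL i x"
    using assms by (intro frac_le) auto
  then show "lower (interval_ratio fL fU gL gU x i) = fL i x / gU i x"
    and "upper (interval_ratio fL fU gL gU x i) = fU i x / gL i x"
    by (simp_all add: interval_ratio_def lower_def upper_def Interval_inverse)
qed

theorem theorem4p1:
  fixes S :: "(real ^ 'n) set"
    and m p :: nat
    and fL fU gL gU h :: "nat \<Rightarrow> real ^ 'n \<Rightarrow> real"
    and x y :: "real ^ 'n"
    and lamL lamU \<mu> :: "nat \<Rightarrow> real"
  assumes "S \<noteq> {}" and "closed S"
    and "\<And>i. i \<in> {1..m} \<Longrightarrow> locally_lipschitz (fL i)"
    and "\<And>i. i \<in> {1..m} \<Longrightarrow> locally_lipschitz (fU i)"
    and "\<And>i. i \<in> {1..m} \<Longrightarrow> locally_lipschitz (gL i)"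
    and "\<And>i. i \<in> {1..m} \<Longrightarrow> locally_lipschitz (gU i)"
    and "\<And>j. j \<in> {1..p} \<Longrightarrow> locally_lipschitz (h j)"
    and "\<And>i u. i \<in> {1..m} \<Longrightarrow> u \<in> S \<Longrightarrow> 0 \<le> fL i u \<and> fL i u \<le> fU i u"
    and "\<And>i u. i \<in> {1..m} \<Longrightarrow> u \<in> S \<Longrightarrow> 0 < gL i u \<and> gL i u \<le> gU i u"
    and "x \<in> feasible_set p S h"
    and "(y, lamL, lamU, \<mu>) \<in> mond_weir_feasible_set m p S fL fU gL gU h"
  shows "(generalized_convex_at m p S fL fU gL gU h y \<longrightarrow>
            \<not> LU_sprec m (interval_ratio fL fU gL gU x)
                         (mond_weir_objective fL fU gL gU (y, lamL, lamU, \<mu>))) \<and>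
         (strictly_generalized_convex_at m p S fL fU gL gU h y \<longrightarrow>
            \<not> LU_prec m (interval_ratio fL fU gL gU x)
                        (mond_weir_objective fL fU gL gU (y, lamL, lamU, \<mu>)))"
proof -
  let ?F = "interval_ratio fL fU gL gU"
  have xS: "x \<in> S" and yS: "y \<in> S"
    using assms(10,11) by (auto simp: feasible_set_def mond_weir_feasible_set_def)
  have pos: "0 \<le> fL i u \<and> 0 \<le> fU i u \<and> 0 < gL i u \<and> 0 < gU i u"
    if "i \<in> {1..m}" "u \<in> S" for i u
    using assms(8,9)[OF that] by linarith
  have F: "lower (?F u i) = fL i u / gU i u" "upper (?F u i) = fU i u / gL i u"
    if "i \<in> {1..m}" "u \<in> S" for i u
    using assms(8,9)[OF that] by (simp_all add: interval_ratio_bounds)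
  have "\<not> LU_sprec m (?F x) (?F y)" if conv: "generalized_convex_at m p S fL fU gL gU h y"
  proof
    assume "LU_sprec m (?F x) (?F y)"
    then have "LU_sless (?F x i) (?F y i)" if "i \<in> {1..m}" for i
      using that by (simp only: LU_sprec_def)
    then have less: "fL i x / gU i x < fL i y / gU i y \<and> fU i x / gL i x < fU i y / gL i y"
      if "i \<in> {1..m}" for i
      using that xS yS by (simp only: LU_sless_def F)
    show False
    proof (rule mond_weir_not_improved[OF pos assms(10,11)], assumption, assumption)
      show "fL i x / gU i x \<le> fL i y / gU i y \<and> fU i x / gL i x \<le> fU i y / gL i y"
        if "i \<in> {1..m}" for i
        using less[OF that] by linarith
    next
      fix xL xU yL yU z
      assume A: "\<forall>i\<in>{1..m}. xL i \<in> limiting_subdifferential (fL i) y \<and>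
                    xU i \<in> limiting_subdifferential (fU i) y \<and>
                    yL i \<in> upper_subdifferential (gL i) y \<and>
                    yU i \<in> upper_subdifferential (gU i) y"
        and B: "\<forall>j\<in>{1..p}. z j \<in> limiting_subdifferential (h j) y"
      \<comment> \<open>The \<open>\<nu>\<close> of generalized convexity serves as it is. Its
        estimates are weak, so each disjunction is met by its second half: both ratios drop strictly
        at every index.\<close>
      show "\<exists>\<nu>\<in>polar_cone (limiting_normal_cone S y).
        (\<forall>i\<in>{1..m}. inner (xL i) \<nu> \<le> fL i x - fL i y \<and>
                    inner (xU i) \<nu> \<le> fU i x - fU i y \<and>
                    gL i x - gL i y \<le> inner (yL i) \<nu> \<and>
                    gU i x - gU i y \<le> inner (yU i) \<nu> \<and>
                    (inner (xL i) \<nu> < fL i x - fL i y \<or> fL i x / gU i x < fL i y / gU i y) \<and>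
                    (inner (xU i) \<nu> < fU i x - fU i y \<or> fU i x / gL i x < fU i y / gL i y)) \<and>
        (\<forall>j\<in>{1..p}. inner (z j) \<nu> \<le> h j x - h j y)"
        using conv[unfolded generalized_convex_at_def, THEN bspec, OF xS,
            THEN spec[of _ xL], THEN spec[of _ xU], THEN spec[of _ yL], THEN spec[of _ yU],
            THEN spec[of _ z], THEN mp, OF conjI[OF A B]]
        by (elim bexE conjE, intro bexI conjI ballI) (use less in blast)+
    qed
  qed
  moreover have "\<not> LU_prec m (?F x) (?F y)"
    if conv: "strictly_generalized_convex_at m p S fL fU gL gU h y"
  proof
    assume prec: "LU_prec m (?F x) (?F y)"
    then have le: "LU_le (?F x i) (?F y i)" if "i \<in> {1..m}" for i
      using that by (simp only: LU_prec_def)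
    have xy: "x \<in> S - {y}"
      using xS prec by (auto simp: LU_prec_def LU_less_def)
    show False
    proof (rule mond_weir_not_improved[OF pos assms(10,11)], assumption, assumption)
      show "fL i x / gU i x \<le> fL i y / gU i y \<and> fU i x / gL i x \<le> fU i y / gL i y"
        if "i \<in> {1..m}" for i
        using le[OF that] that xS yS by (simp only: LU_le_def F)
    next
      fix xL xU yL yU z
      assume A: "\<forall>i\<in>{1..m}. xL i \<in> limiting_subdifferential (fL i) y \<and>
                    xU i \<in> limiting_subdifferential (fU i) y \<and>
                    yL i \<in> upper_subdifferential (gL i) y \<and>
                    yU i \<in> upper_subdifferential (gU i) y"
        and B: "\<forall>j\<in>{1..p}. z j \<in> limiting_subdifferential (h j) y"
      \<comment> \<open>Ratios may tie at some indices here, so each disjunction is met by its first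
        half, the strict estimate on the numerator, which also implies the weak one.\<close>
      show "\<exists>\<nu>\<in>polar_cone (limiting_normal_cone S y).
        (\<forall>i\<in>{1..m}. inner (xL i) \<nu> \<le> fL i x - fL i y \<and>
                    inner (xU i) \<nu> \<le> fU i x - fU i y \<and>
                    gL i x - gL i y \<le> inner (yL i) \<nu> \<and>
                    gU i x - gU i y \<le> inner (yU i) \<nu> \<and>
                    (inner (xL i) \<nu> < fL i x - fL i y \<or> fL i x / gU i x < fL i y / gU i y) \<and>
                    (inner (xU i) \<nu> < fU i x - fU i y \<or> fU i x / gL i x < fU i y / gL i y)) \<and>
        (\<forall>j\<in>{1..p}. inner (z j) \<nu> \<le> h j x - h j y)"
        using conv[unfolded strictly_generalized_convex_at_def, THEN bspec, OF xy,
            THEN spec[of _ xL], THEN spec[of _ xU], THEN spec[of _ yL], THEN spec[of _ yU],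
            THEN spec[of _ z], THEN mp, OF conjI[OF A B]]
        by (elim bexE conjE, intro bexI conjI ballI) (use less_imp_le in blast)+
    qed
  qed
  ultimately show ?thesis
    by (simp add: mond_weir_objective_def)
qed

end
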